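(* Consider the discretized optomechanical system $x_{k+1}=Ax_k+Bf_k+w_k$, $y_k=Hx_k+v_k$ with unknown scalar input (external force) $f_k$, where $B$ has full column rank. Let $\hat x_{k|k}$ be the unbiased minimum variance Kalman filter state estimates with gains $L_{k+1}$, and let $\hat f_k=B^{+}[\hat x_{k+1|k+1}-A\hat x_{k|k}]$ be the force estimator, all as defined in the context. Then, for every $k\ge 0$, the mean squared errors $\varepsilon_{f_k}^2=E[(\hat f_k-f_k)(\hat f_k-f_k)^T]$ and $\varepsilon_{x_k}^2=E[(\hat x_{k|k}-x_k)(\hat x_{k|k}-x_k)^T]$ of the force and state estimators satisfy $$\varepsilon_{f_k}^2=M_{k+1}HA\,\varepsilon_{x_k}^2\,A^TH^TM_{k+1}^T+M_{k+1}HQ_kH^TM_{k+1}^T+M_{k+1}R_{k+1}M_{k+1}^T,$$ where $M_{k+1}=B^{+}L_{k+1}$, and $Q_k$ and $R_{k+1}$ are the covariances of the backaction noise $w_k$ and of the measurement noise $v_{k+1}$, respectively.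
   Context: Let $m,\omega_m,\Delta t,D_0,R_0>0$ be real constants and set $$A_0=\begin{bmatrix}0&1/m\\-m\omega_m^2&0\end{bmatrix},\quad B_0=\begin{bmatrix}0\\1\end{bmatrix},\quad H_0=\begin{bmatrix}1&0\end{bmatrix},\quad Q_0=\mathrm{diag}(0,D_0).$$ The discretized system with sampling period $\Delta t$ is $$x_{k+1}=Ax_k+Bf_k+w_k,\qquad y_k=Hx_k+v_k,\qquad k\ge 0,$$ where $$A=e^{A_0\Delta t},\quad B=\int_0^{\Delta t}e^{A_0\tau}\,d\tau\,B_0,\quad H=H_0,\quad Q_k=\int_0^{\Delta t}e^{A_0\tau}Q_0e^{A_0^T\tau}\,d\tau,\quad R_k=R_0/\Delta t$$ (so $Q_k$ and $R_k$ do not depend on $k$). Here $x_k$ is the $\mathbb{R}^2$-valued state, $y_k$ is the real-valued measurement output, and $f_k$ is the unknown real-valued input (external force), deterministic or stochastic, with finite second moment. The sequences $(w_k)$ ($\mathbb{R}^2$-valued, backaction noise) and $(v_k)$ (real-valued, measurement noise) are zero-mean white Gaussian noises with covariances $Q_k$ and $R_k$ respectively; they are uncorrelated with each other and with the initial state $x_0$ and initial estimate $\hat x_{0|0}$, which have finite second moments. The matrix $B$ is assumed to have full column rank, and $B^{+}=(B^TB)^{-1}B^T$ is its Moore-Penrose inverse. The unbiased minimum variance Kalman filter starts from an unbiased initial estimate $\hat x_{0|0}$ (that is, $E[\hat x_{0|0}]=E[x_0]$) with $P_{0|0}=E[(x_0-\hat x_{0|0})(x_0-\hat x_{0|0})^T]$,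 and is given for $k\ge 0$ by $$\hat x_{k+1|k+1}=A\hat x_{k|k}+L_{k+1}\left[y_{k+1}-HA\hat x_{k|k}\right],$$ with $$P_{k+1|k}=AP_{k|k}A^T+Q_k,\qquad C_{k+1}=HP_{k+1|k}H^T+R_k,$$ $$L_{k+1}=P_{k+1|k}H^TC_{k+1}^{-1}+\left[B-P_{k+1|k}H^TC_{k+1}^{-1}HB\right]\left[B^TH^TC_{k+1}^{-1}HB\right]^{-1}B^TH^TC_{k+1}^{-1},$$ $$P_{k+1|k+1}=P_{k+1|k}-P_{k+1|k}H^TC_{k+1}^{-1}HP_{k+1|k}+\left[B-P_{k+1|k}H^TC_{k+1}^{-1}HB\right]\left[B^TH^TC_{k+1}^{-1}HB\right]^{-1}\left[B-P_{k+1|k}H^TC_{k+1}^{-1}HB\right]^T.$$ The force estimator is $\hat f_k=B^{+}[\hat x_{k+1|k+1}-A\hat x_{k|k}]$. *)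

theory Defs
  imports "HOL-Analysis.Analysis" "HOL-Probability.Probability"
begin

primrec matrix_pow :: "real^'n^'n \<Rightarrow> nat \<Rightarrow> real^'n^'n" where
  "matrix_pow X 0 = mat 1"
| "matrix_pow X (Suc n) = X ** matrix_pow X n"

text \<open>The library \<^const>\<open>exp\<close> is not available here: square matrices are not an instance of
  \<^class>\<open>real_normed_algebra_1\<close>, and \<open>*\<close> on vectors is componentwise.\<close>

definition matrix_exp :: "real^'n^'n \<Rightarrow> real^'n^'n" where
  "matrix_exp X = (\<Sum>n. (1 / fact n) *\<^sub>R matrix_pow X n)"

text \<open>This is the Moore-Penrose inverse when \<open>B\<close> has full column rank, the only case in which it
  is used.\<close>

definition pinv_full_col :: "real^'n^'m \<Rightarrow> real^'m^'n" where
  "pinv_full_col B = matrix_inv (transpose B ** B) ** transpose B"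

definition outer_prod :: "real^'m \<Rightarrow> real^'n \<Rightarrow> real^'n^'m" where
  "outer_prod u v = (\<chi> i j. u $ i * v $ j)"

definition finite_second_moment :: "'s measure \<Rightarrow> ('s \<Rightarrow> real^'n) \<Rightarrow> bool" where
  "finite_second_moment \<Omega> X \<longleftrightarrow>
     X \<in> borel_measurable \<Omega> \<and> integrable \<Omega> (\<lambda>s. (norm (X s))\<^sup>2)"

definition cross_cov :: "'s measure \<Rightarrow> ('s \<Rightarrow> real^'m) \<Rightarrow> ('s \<Rightarrow> real^'n) \<Rightarrow> real^'n^'m" where
  "cross_cov \<Omega> X Y =
     integral\<^sup>L \<Omega> (\<lambda>s. outer_prod (X s - integral\<^sup>L \<Omega> X) (Y s - integral\<^sup>L \<Omega> Y))"

definition uncorrelated :: "'s measure \<Rightarrow> ('s \<Rightarrow> real^'m) \<Rightarrow> ('s \<Rightarrow> real^'n) \<Rightarrow> bool" where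
  "uncorrelated \<Omega> X Y \<longleftrightarrow> cross_cov \<Omega> X Y = 0"

definition mse :: "'s measure \<Rightarrow> ('s \<Rightarrow> real^'n) \<Rightarrow> ('s \<Rightarrow> real^'n) \<Rightarrow> real^'n^'n" where
  "mse \<Omega> X Y = integral\<^sup>L \<Omega> (\<lambda>s. outer_prod (X s - Y s) (X s - Y s))"

text \<open>A random vector is Gaussian iff all its linear functionals are univariate normal;
  \<open>\<sigma> = 0\<close> is the degenerate (constant) case, which at least \<open>u = 0\<close> requires.\<close>

definition gaussian_vector :: "'s measure \<Rightarrow> ('s \<Rightarrow> real^'n) \<Rightarrow> bool" where
  "gaussian_vector \<Omega> X \<longleftrightarrow>
     X \<in> borel_measurable \<Omega> \<and>
     (\<forall>u. \<exists>\<mu> \<sigma>. 0 \<le> \<sigma> \<and>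
        (if \<sigma> = 0 then AE s in \<Omega>. u \<bullet> X s = \<mu>
         else distributed \<Omega> lborel (\<lambda>s. u \<bullet> X s) (\<lambda>t. ennreal (normal_density \<mu> \<sigma> t))))"

text \<open>White means uncorrelated at distinct times. Joint Gaussianity of the whole sequence is not
  demanded, so jointly Gaussian white noise is included.\<close>

definition white_gaussian_noise ::
    "'s measure \<Rightarrow> (nat \<Rightarrow> 's \<Rightarrow> real^'n) \<Rightarrow> real^'n^'n \<Rightarrow> bool" where
  "white_gaussian_noise \<Omega> w Q \<longleftrightarrow>
     (\<forall>k. gaussian_vector \<Omega> (w k)) \<and>
     (\<forall>k. integral\<^sup>L \<Omega> (w k) = 0) \<and>
     (\<forall>k. cross_cov \<Omega> (w k) (w k) = Q) \<and>
     (\<forall>j k. j \<noteq> k \<longrightarrow> uncorrelated \<Omega> (w j) (w k))"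

text \<open>Scalar signals are \<^typ>\<open>real^1\<close>-valued, so that inputs and outputs are column vectors and
  the filter equations are literal matrix products.\<close>

definition A0_mat :: "real \<Rightarrow> real \<Rightarrow> real^2^2" where
  "A0_mat m \<omega>\<^sub>m = vector [vector [0, 1 / m], vector [- m * \<omega>\<^sub>m\<^sup>2, 0]]"

definition B0_mat :: "real^1^2" where
  "B0_mat = vector [vector [0], vector [1]]"

definition H0_mat :: "real^2^1" where
  "H0_mat = vector [vector [1, 0]]"

definition Q0_mat :: "real \<Rightarrow> real^2^2" where
  "Q0_mat D\<^sub>0 = vector [vector [0, 0], vector [0, D\<^sub>0]]"

end

theory Submission
  imports Defs
begin

text \<open>The gain satisfies \<open>L H B = B\<close>, so the unknown force cancels from the recursion of the state
  error \<open>e\<close>, which becomes linear in the initial error and the past noises. Hence \<open>e k\<close> has finite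
  second moment and is orthogonal to \<open>w k\<close> and \<open>v (k+1)\<close>. Since \<open>B\<^sup>+ B = 1\<close>, the force error is
  \<open>M (H A e k + H w k + v (k+1))\<close>, and the formula follows by orthogonality. The identity
  \<open>L H B = B\<close> needs two inverses to exist: that of \<open>C\<close>, which is positive definite because every
  \<open>P k\<close> is positive semidefinite and \<open>R > 0\<close>, and that of \<open>B\<^sup>T H\<^sup>T C\<^sup>-\<^sup>1 H B\<close>, for which \<open>H B \<noteq> 0\<close> is
  required. The latter holds because \<open>H B = (1 - cos \<omega>t) / (m \<omega>\<^sup>2)\<close> and \<open>B\<close> has second entry
  \<open>sin \<omega>t / \<omega>\<close>, so \<open>H B = 0\<close> forces \<open>B = 0\<close>.\<close>

subsection \<open>Positive definite matrices and the Kalman gain\<close>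

lemma matrix_add_mult_distrib:
  fixes A B :: "real^'n^'m"
  shows "(A + B) ** C = A ** C + B ** C"
  by (simp add: matrix_matrix_mult_def vec_eq_iff sum.distrib distrib_right)

lemma matrix_diff_mult_distrib:
  fixes A B :: "real^'n^'m"
  shows "(A - B) ** C = A ** C - B ** C"
  by (simp add: matrix_matrix_mult_def vec_eq_iff sum_subtractf left_diff_distrib)

lemma matrix_mult_diff_distrib:
  fixes A :: "real^'n^'m"
  shows "A ** (B - C) = A ** B - A ** C"
  by (simp add: matrix_matrix_mult_def vec_eq_iff sum_subtractf right_diff_distrib)

lemma matrix_vector_mult_minus: "(- A) *v x = - (A *v x)"
  for A :: "real^'n^'m"
  by (simp add: matrix_vector_mult_def vec_eq_iff sum_negf)

lemma transpose_add: "transpose (A + B) = transpose A + transpose B"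
  by (simp add: transpose_def vec_eq_iff)

lemma transpose_diff: "transpose (A - B) = transpose A - transpose B"
  by (simp add: transpose_def vec_eq_iff)

lemma inner_matrix_vector_mult: "u \<bullet> (A *v x) = (transpose A *v u) \<bullet> x"
  for A :: "real^'n^'m"
  using dot_lmul_matrix[of u A x] by simp

lemma matrix_inv_cancel:
  fixes A :: "real^'n^'n"
  assumes "invertible A"
  shows "A ** matrix_inv A = mat 1" "matrix_inv A ** A = mat 1"
  using someI_ex[OF assms[unfolded invertible_def]] by (simp_all add: matrix_inv_def)

lemma transpose_matrix_inv:
  fixes A :: "real^'n^'n"
  assumes "invertible A" "transpose A = A"
  shows "transpose (matrix_inv A) = matrix_inv A"
proof -
  have "transpose (matrix_inv A) = transpose (matrix_inv A) ** (A ** matrix_inv A)"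
    by (simp add: matrix_inv_cancel assms)
  also have "\<dots> = transpose (A ** matrix_inv A) ** matrix_inv A"
    by (simp add: matrix_transpose_mul assms matrix_mul_assoc)
  finally show ?thesis
    by (simp add: matrix_inv_cancel assms)
qed

definition psd_matrix :: "real^'n^'n \<Rightarrow> bool" where
  "psd_matrix X \<longleftrightarrow> transpose X = X \<and> (\<forall>u. 0 \<le> u \<bullet> (X *v u))"

definition pos_def_matrix :: "real^'n^'n \<Rightarrow> bool" where
  "pos_def_matrix X \<longleftrightarrow> transpose X = X \<and> (\<forall>u. u \<noteq> 0 \<longrightarrow> 0 < u \<bullet> (X *v u))"

lemma pos_def_imp_psd: "pos_def_matrix X \<Longrightarrow> psd_matrix X"
  by (auto simp: psd_matrix_def pos_def_matrix_def intro: order.strict_implies_order)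
     (metis inner_zero_left order.refl order.strict_implies_order)

lemma psd_matrix_add: "psd_matrix X \<Longrightarrow> psd_matrix Y \<Longrightarrow> psd_matrix (X + Y)"
  by (simp add: psd_matrix_def transpose_add matrix_vector_mult_add_rdistrib inner_add_right)

lemma pos_def_matrix_add: "psd_matrix X \<Longrightarrow> pos_def_matrix Y \<Longrightarrow> pos_def_matrix (X + Y)"
  by (auto simp: psd_matrix_def pos_def_matrix_def transpose_add matrix_vector_mult_add_rdistrib
      inner_add_right add_nonneg_pos)

lemma inner_congruence:
  fixes A :: "real^'n^'m"
  shows "u \<bullet> ((A ** X ** transpose A) *v u) = (transpose A *v u) \<bullet> (X *v (transpose A *v u))"
  by (simp only: inner_matrix_vector_mult flip: matrix_vector_mul_assoc)

lemma transpose_congruence: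
  fixes A :: "real^'n^'m"
  shows "transpose X = X \<Longrightarrow> transpose (A ** X ** transpose A) = A ** X ** transpose A"
  by (simp add: matrix_transpose_mul matrix_mul_assoc)

lemma psd_matrix_congruence: "psd_matrix X \<Longrightarrow> psd_matrix (A ** X ** transpose A)"
  unfolding psd_matrix_def inner_congruence by (blast intro: transpose_congruence)

lemma pos_def_matrix_congruence:
  assumes "pos_def_matrix X" "inj ((*v) G)"
  shows "pos_def_matrix (transpose G ** X ** G)"
proof -
  have "G *v u \<noteq> 0" if "u \<noteq> 0" for u
    using assms(2) that by (metis injD matrix_vector_mult_0_right)
  then show ?thesis
    using assms(1) transpose_congruence[of X "transpose G"] inner_congruence[of _ "transpose G" X]
    by (simp add: pos_def_matrix_def del: transpose_matrix_vector)
qed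

lemma pos_def_matrix_mat:
  assumes "0 < c"
  shows "pos_def_matrix (mat c :: real^'n^'n)"
proof -
  have "mat c = c *\<^sub>R (mat 1 :: real^'n^'n)"
    by (simp add: mat_def vec_eq_iff)
  then show ?thesis
    using assms by (simp add: pos_def_matrix_def scaleR_matrix_vector_assoc[symmetric] transpose_scalar)
qed

lemma pos_def_matrix_invertible:
  assumes "pos_def_matrix X"
  shows "invertible X"
proof -
  have "u = 0" if "X *v u = 0" for u
    using assms that by (metis inner_zero_right less_irrefl pos_def_matrix_def)
  then show ?thesis
    using matrix_left_invertible_ker[of X] invertible_left_inverse[of X] by blast
qed

lemma pos_def_matrix_inv:
  assumes "pos_def_matrix X"
  shows "pos_def_matrix (matrix_inv X)"
proof -
  note inv = pos_def_matrix_invertible[OF assms]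
  have sym: "transpose (matrix_inv X) = matrix_inv X"
    using assms inv by (simp add: pos_def_matrix_def transpose_matrix_inv)
  have "inj ((*v) (matrix_inv X))"
    using inv matrix_inv_cancel[OF inv] by (intro inj_matrix_vector_mult) (auto simp: invertible_def)
  from pos_def_matrix_congruence[OF assms this] show ?thesis
    by (simp add: sym matrix_inv_cancel[OF inv])
qed

lemma pinv_full_col_left_inverse:
  fixes B :: "real^'n^'m"
  assumes "rank B = CARD('n)"
  shows "pinv_full_col B ** B = mat 1"
proof -
  have "inj ((*v) B)"
    using assms by (simp add: full_rank_injective)
  from pos_def_matrix_congruence[OF pos_def_matrix_mat this, of 1]
  have "invertible (transpose B ** B)"
    by (simp add: pos_def_matrix_invertible)
  then show ?thesis
    by (simp add: pinv_full_col_def matrix_inv_cancel flip: matrix_mul_assoc)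
qed

text \<open>The Joseph form exhibits the corrected covariance as a sum of congruences.\<close>

lemma psd_matrix_kalman_correction:
  fixes X :: "real^'n^'n" and H :: "real^'n^'p"
  assumes X: "psd_matrix X" and R: "pos_def_matrix R"
  defines "C \<equiv> H ** X ** transpose H + R"
  shows "psd_matrix (X - X ** transpose H ** matrix_inv C ** H ** X)"
proof -
  define K where "K = X ** transpose H ** matrix_inv C"
  have "pos_def_matrix C"
    unfolding C_def by (intro pos_def_matrix_add psd_matrix_congruence X R)
  then have inv: "invertible C"
    by (rule pos_def_matrix_invertible)
  have KC: "K ** C = X ** transpose H"
    by (simp add: K_def matrix_inv_cancel[OF inv] flip: matrix_mul_assoc)
  have "(mat 1 - K ** H) ** X ** transpose (mat 1 - K ** H) + K ** R ** transpose K
      = X - K ** H ** X - X ** transpose H ** transpose K + K ** C ** transpose K"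
    by (simp add: C_def transpose_diff matrix_transpose_mul matrix_mul_assoc matrix_add_ldistrib
        matrix_add_mult_distrib matrix_diff_mult_distrib matrix_mult_diff_distrib)
  also have "\<dots> = X - X ** transpose H ** matrix_inv C ** H ** X"
    unfolding KC by (simp add: K_def)
  finally show ?thesis
    using psd_matrix_add[OF psd_matrix_congruence[OF X] psd_matrix_congruence[OF pos_def_imp_psd[OF R]]]
    by metis
qed

definition kalman_gain ::
    "real^'n^'n \<Rightarrow> real^'q^'n \<Rightarrow> real^'n^'p \<Rightarrow> real^'p^'p \<Rightarrow> real^'p^'n" where
  "kalman_gain X B H C =
     X ** transpose H ** matrix_inv C
     + (B - X ** transpose H ** matrix_inv C ** H ** B)
       ** matrix_inv (transpose B ** transpose H ** matrix_inv C ** H ** B)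
       ** transpose B ** transpose H ** matrix_inv C"

lemma innovation_weight_pos_def:
  assumes "pos_def_matrix C" "inj ((*v) (H ** B))"
  shows "pos_def_matrix (transpose B ** transpose H ** matrix_inv C ** H ** B)"
  using pos_def_matrix_congruence[OF pos_def_matrix_inv[OF assms(1)] assms(2)]
  by (simp add: matrix_transpose_mul matrix_mul_assoc)

lemma kalman_gain_decouples_input:
  assumes "pos_def_matrix C" "inj ((*v) (H ** B))"
  shows "kalman_gain X B H C ** H ** B = B"
proof -
  define S where "S = transpose B ** transpose H ** matrix_inv C ** H ** B"
  define K where "K = X ** transpose H ** matrix_inv C"
  have "matrix_inv S ** S = mat 1"
    using innovation_weight_pos_def[OF assms] by (simp add: S_def matrix_inv_cancel pos_def_matrix_invertible)
  moreover have "kalman_gain X B H C ** H ** B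
      = K ** H ** B + (B - K ** H ** B) ** (matrix_inv S ** S)"
    by (simp add: kalman_gain_def S_def K_def matrix_add_mult_distrib matrix_mul_assoc)
  ultimately show ?thesis
    by simp
qed

subsection \<open>The discretized oscillator\<close>

lemma matrix_exp_rotation:
  fixes J :: "real^'n^'n"
  assumes "J ** J = - mat 1"
  shows "matrix_exp (\<theta> *\<^sub>R J) = cos \<theta> *\<^sub>R mat 1 + sin \<theta> *\<^sub>R J"
proof -
  have eq: "(1 / fact n) *\<^sub>R matrix_pow (\<theta> *\<^sub>R J) n
      = (cos_coeff n *\<^sub>R \<theta> ^ n) *\<^sub>R mat 1 + (sin_coeff n *\<^sub>R \<theta> ^ n) *\<^sub>R J" for n
  proof (induction n)
    case 0
    then show ?case by simp
  next
    case (Suc n)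
    have "(1 / fact (Suc n)) *\<^sub>R matrix_pow (\<theta> *\<^sub>R J) (Suc n)
        = (\<theta> / real (Suc n)) *\<^sub>R (J ** ((1 / fact n) *\<^sub>R matrix_pow (\<theta> *\<^sub>R J) n))"
      by (simp add: matrix_scalar_ac flip: scalar_matrix_assoc)
    also have "\<dots> = (cos_coeff (Suc n) *\<^sub>R \<theta> ^ Suc n) *\<^sub>R mat 1
        + (sin_coeff (Suc n) *\<^sub>R \<theta> ^ Suc n) *\<^sub>R J"
      unfolding Suc
      by (simp add: matrix_add_ldistrib matrix_scalar_ac assms cos_coeff_Suc sin_coeff_Suc
          scaleR_diff_right mult_ac del: of_nat_Suc flip: scalar_matrix_assoc)
    finally show ?case .
  qed
  have "(\<lambda>n. (cos_coeff n *\<^sub>R \<theta> ^ n) *\<^sub>R mat 1 + (sin_coeff n *\<^sub>R \<theta> ^ n) *\<^sub>R J)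
      sums (cos \<theta> *\<^sub>R mat 1 + sin \<theta> *\<^sub>R J)"
    by (intro sums_add sums_scaleR_left cos_converges sin_converges)
  then show ?thesis
    by (simp only: matrix_exp_def eq sums_unique[symmetric])
qed

lemma input_matrix_eq:
  fixes m \<omega> t :: real
  assumes "m > 0" "\<omega> > 0" "t > 0"
  shows "integral {0..t} (\<lambda>\<tau>. matrix_exp (\<tau> *\<^sub>R A0_mat m \<omega>)) ** B0_mat
    = vector [vector [(1 - cos (\<omega> * t)) / (m * \<omega>\<^sup>2)], vector [sin (\<omega> * t) / \<omega>]]"
proof -
  define J where "J = (1 / \<omega>) *\<^sub>R A0_mat m \<omega>"
  have J2: "J ** J = - mat 1"
    using assms by (simp add: J_def A0_mat_def matrix_matrix_mult_def mat_def vec_eq_iff forall_2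
        sum_2 power2_eq_square)
  have exp: "matrix_exp (\<tau> *\<^sub>R A0_mat m \<omega>) = cos (\<omega> * \<tau>) *\<^sub>R mat 1 + sin (\<omega> * \<tau>) *\<^sub>R J" for \<tau>
    using matrix_exp_rotation[OF J2, of "\<omega> * \<tau>"] assms by (simp add: J_def)
  have "((\<lambda>\<tau>. matrix_exp (\<tau> *\<^sub>R A0_mat m \<omega>)) has_integral
      ((sin (\<omega> * t) / \<omega>) *\<^sub>R mat 1 + (- cos (\<omega> * t) / \<omega>) *\<^sub>R J)
      - ((sin (\<omega> * 0) / \<omega>) *\<^sub>R mat 1 + (- cos (\<omega> * 0) / \<omega>) *\<^sub>R J)) {0..t}"
    unfolding exp using assms
    by (intro fundamental_theorem_of_calculus)
       (auto intro!: derivative_eq_intros has_vector_derivative_real_field)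
  then show ?thesis
    using assms
    by (simp add: integral_unique J_def A0_mat_def B0_mat_def matrix_matrix_mult_def mat_def
        vec_eq_iff forall_1 forall_2 sum_2 field_simps power2_eq_square)
qed

lemma input_observable:
  fixes m \<omega> t :: real
  assumes "m > 0" "\<omega> > 0" "t > 0"
    and B: "B = integral {0..t} (\<lambda>\<tau>. matrix_exp (\<tau> *\<^sub>R A0_mat m \<omega>)) ** B0_mat"
    and rank: "rank B = CARD(1)"
  shows "inj ((*v) (H0_mat ** B))"
proof -
  note B' = B[unfolded input_matrix_eq[OF assms(1-3)]]
  have "cos (\<omega> * t) \<noteq> 1"
  proof
    assume c: "cos (\<omega> * t) = 1"
    then have "sin (\<omega> * t) = 0"
      using sin_cos_squared_add[of "\<omega> * t"] by simp
    with c have "B = 0"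
      by (simp add: B' vec_eq_iff forall_1 forall_2)
    then show False
      using rank by simp
  qed
  then have "H0_mat ** B *v u = 0 \<Longrightarrow> u = 0" for u
    using assms(1,2)
    by (simp add: B' H0_mat_def matrix_matrix_mult_def matrix_vector_mult_def vec_eq_iff forall_1 sum_2)
  then show ?thesis
    using matrix_left_invertible_ker matrix_left_invertible_injective by metis
qed

subsection \<open>Second moments of random vectors\<close>

lemma outer_prod_add_left: "outer_prod (x + y) z = outer_prod x z + outer_prod y z"
  by (simp add: outer_prod_def vec_eq_iff distrib_right)

lemma outer_prod_mult_left: "outer_prod (M *v x) y = M ** outer_prod x y"
  by (simp add: outer_prod_def vec_eq_iff matrix_vector_mult_def matrix_matrix_mult_def
      sum_distrib_right mult.assoc)

lemma transpose_outer_prod: "transpose (outer_prod x y) = outer_prod y x"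
  by (simp add: outer_prod_def vec_eq_iff transpose_def mult.commute)

lemma bounded_bilinear_outer_prod:
  "bounded_bilinear (outer_prod :: real^'m \<Rightarrow> real^'n \<Rightarrow> real^'n^'m)"
  unfolding bilinear_conv_bounded_bilinear[symmetric]
  by (auto simp: bilinear_def outer_prod_def vec_eq_iff algebra_simps intro!: linearI)

lemma bounded_linear_transpose: "bounded_linear (transpose :: real^'n^'m \<Rightarrow> real^'m^'n)"
  unfolding linear_conv_bounded_linear[symmetric]
  by (auto simp: transpose_def vec_eq_iff intro!: linearI)

lemma bounded_linear_matrix_mult_right:
  "bounded_linear (\<lambda>X::real^'p^'n. (M :: real^'n^'m) ** X)"
  unfolding linear_conv_bounded_linear[symmetric]
  by (auto simp: matrix_add_ldistrib matrix_scalar_ac scalar_matrix_assoc intro!: linearI)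

lemma bounded_linear_quadratic_form: "bounded_linear (\<lambda>X::real^'n^'n. u \<bullet> (X *v u))"
  unfolding linear_conv_bounded_linear[symmetric]
  by (auto simp: matrix_vector_mult_add_rdistrib inner_add_right scaleR_matrix_vector_assoc[symmetric]
      intro!: linearI)

lemma quadratic_form_outer_prod: "u \<bullet> (outer_prod x x *v u) = (u \<bullet> x)\<^sup>2"
  by (simp add: outer_prod_def inner_vec_def matrix_vector_mult_def power2_eq_square
      sum_product sum_distrib_left mult_ac)

lemma finite_second_moment_cong:
  assumes "\<And>s. s \<in> space \<Omega> \<Longrightarrow> X s = Y s"
  shows "finite_second_moment \<Omega> X \<longleftrightarrow> finite_second_moment \<Omega> Y"
  unfolding finite_second_moment_def
  using assms by (intro conj_cong measurable_cong Bochner_Integration.integrable_cong) auto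

lemma finite_second_moment_add:
  fixes X Y :: "'s \<Rightarrow> real^'n"
  assumes X: "finite_second_moment \<Omega> X" and Y: "finite_second_moment \<Omega> Y"
  shows "finite_second_moment \<Omega> (\<lambda>s. X s + Y s)"
proof -
  have [measurable]: "X \<in> borel_measurable \<Omega>" "Y \<in> borel_measurable \<Omega>"
    using X Y by (auto simp: finite_second_moment_def)
  have "(norm (x + y))\<^sup>2 \<le> 2 * (norm x)\<^sup>2 + 2 * (norm y)\<^sup>2" for x y :: "real^'n"
    using sum_squares_bound[of "norm x" "norm y"] power_mono[OF norm_triangle_ineq[of x y], of 2]
    by (simp add: power2_sum)
  moreover have "integrable \<Omega> (\<lambda>s. 2 * (norm (X s))\<^sup>2 + 2 * (norm (Y s))\<^sup>2)"
    using X Y by (auto simp: finite_second_moment_def)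
  ultimately have "integrable \<Omega> (\<lambda>s. (norm (X s + Y s))\<^sup>2)"
    by (elim Bochner_Integration.integrable_bound) auto
  then show ?thesis
    by (simp add: finite_second_moment_def)
qed

lemma finite_second_moment_mult:
  fixes M :: "real^'n^'m"
  assumes X: "finite_second_moment \<Omega> X"
  shows "finite_second_moment \<Omega> (\<lambda>s. M *v X s)"
proof -
  have [measurable]: "X \<in> borel_measurable \<Omega>"
    using X by (auto simp: finite_second_moment_def)
  have [measurable]: "(\<lambda>s. M *v X s) \<in> borel_measurable \<Omega>"
    by (rule measurable_compose[OF \<open>X \<in> borel_measurable \<Omega>\<close>])
       (intro borel_measurable_continuous_onI linear_continuous_on matrix_vector_mul_bounded_linear)
  obtain c where c: "\<And>x. norm (M *v x) \<le> norm x * c"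
    using bounded_linear.bounded[OF matrix_vector_mul_bounded_linear[of M]] by blast
  have "(norm (M *v x))\<^sup>2 \<le> c\<^sup>2 * (norm x)\<^sup>2" for x
    using power_mono[OF c, of x 2] by (simp add: power_mult_distrib mult.commute)
  moreover have "integrable \<Omega> (\<lambda>s. c\<^sup>2 * (norm (X s))\<^sup>2)"
    using X by (auto simp: finite_second_moment_def)
  ultimately have "integrable \<Omega> (\<lambda>s. (norm (M *v X s))\<^sup>2)"
    by (elim Bochner_Integration.integrable_bound) auto
  then show ?thesis
    by (simp add: finite_second_moment_def)
qed

lemma finite_second_moment_uminus:
  "finite_second_moment \<Omega> X \<Longrightarrow> finite_second_moment \<Omega> (\<lambda>s. - X s)"
  by (simp add: finite_second_moment_def)

lemma finite_second_moment_diff: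
  assumes "finite_second_moment \<Omega> X" "finite_second_moment \<Omega> Y"
  shows "finite_second_moment \<Omega> (\<lambda>s. X s - Y s)"
  using finite_second_moment_add[OF assms(1) finite_second_moment_uminus[OF assms(2)]] by simp

lemma (in prob_space) finite_second_moment_integrable:
  fixes X :: "'a \<Rightarrow> real^'n"
  assumes X: "finite_second_moment M X"
  shows "integrable M X"
proof (rule Bochner_Integration.integrable_bound)
  show "integrable M (\<lambda>s. 1 + (norm (X s))\<^sup>2)"
    using X by (simp add: finite_second_moment_def)
  have "norm x \<le> 1 + (norm x)\<^sup>2" for x :: "real^'n"
    using sum_squares_bound[of "norm x" 1] norm_ge_zero[of x] unfolding power_one mult_1_right by linarith
  then show "AE s in M. norm (X s) \<le> norm (1 + (norm (X s))\<^sup>2)"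
    by (simp add: add_nonneg_nonneg)
qed (use X in \<open>simp add: finite_second_moment_def\<close>)

lemma integrable_outer_prod:
  fixes X :: "'s \<Rightarrow> real^'m" and Y :: "'s \<Rightarrow> real^'n"
  assumes X: "finite_second_moment \<Omega> X" and Y: "finite_second_moment \<Omega> Y"
  shows "integrable \<Omega> (\<lambda>s. outer_prod (X s) (Y s))"
proof -
  interpret op: bounded_bilinear "outer_prod :: real^'m \<Rightarrow> real^'n \<Rightarrow> real^'n^'m"
    by (rule bounded_bilinear_outer_prod)
  have [measurable]: "X \<in> borel_measurable \<Omega>" "Y \<in> borel_measurable \<Omega>"
    using X Y by (auto simp: finite_second_moment_def)
  have [measurable]: "(\<lambda>s. outer_prod (X s) (Y s)) \<in> borel_measurable \<Omega>"
    by (rule borel_measurable_continuous_Pair) (auto intro!: continuous_intros op.continuous_on)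
  obtain c where c: "0 < c" "\<And>x y. norm (outer_prod (x::real^'m) (y::real^'n)) \<le> norm x * norm y * c"
    using op.pos_bounded by blast
  have "norm (outer_prod x y) \<le> c * ((norm x)\<^sup>2 + (norm y)\<^sup>2)" for x :: "real^'m" and y :: "real^'n"
  proof -
    have "norm x * norm y \<le> (norm x)\<^sup>2 + (norm y)\<^sup>2"
      using sum_squares_bound[of "norm x" "norm y"] mult_nonneg_nonneg[of "norm x" "norm y"]
      by (simp del: mult_nonneg_nonneg zero_le_mult_iff)
    then show ?thesis
      using c(2)[of x y] mult_left_mono[of _ _ c] c(1) by (smt (verit) mult.commute)
  qed
  moreover have "integrable \<Omega> (\<lambda>s. c * ((norm (X s))\<^sup>2 + (norm (Y s))\<^sup>2))"
    using X Y by (auto simp: finite_second_moment_def)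
  ultimately show ?thesis
    by (elim Bochner_Integration.integrable_bound) (auto intro: order_trans[OF _ abs_ge_self])
qed

definition cross_moment :: "'s measure \<Rightarrow> ('s \<Rightarrow> real^'m) \<Rightarrow> ('s \<Rightarrow> real^'n) \<Rightarrow> real^'n^'m" where
  "cross_moment \<Omega> X Y = integral\<^sup>L \<Omega> (\<lambda>s. outer_prod (X s) (Y s))"

lemma cross_moment_cong:
  assumes "\<And>s. s \<in> space \<Omega> \<Longrightarrow> X s = X' s" "\<And>s. s \<in> space \<Omega> \<Longrightarrow> Y s = Y' s"
  shows "cross_moment \<Omega> X Y = cross_moment \<Omega> X' Y'"
  unfolding cross_moment_def using assms by (intro Bochner_Integration.integral_cong) auto

lemma transpose_cross_moment:
  assumes "finite_second_moment \<Omega> X" "finite_second_moment \<Omega> Y"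
  shows "transpose (cross_moment \<Omega> X Y) = cross_moment \<Omega> Y X"
  using integral_bounded_linear[OF bounded_linear_transpose integrable_outer_prod[OF assms]]
  by (simp add: cross_moment_def transpose_outer_prod)

lemma cross_moment_add_left:
  assumes "finite_second_moment \<Omega> X" "finite_second_moment \<Omega> Y" "finite_second_moment \<Omega> Z"
  shows "cross_moment \<Omega> (\<lambda>s. X s + Y s) Z = cross_moment \<Omega> X Z + cross_moment \<Omega> Y Z"
  by (simp add: cross_moment_def outer_prod_add_left integrable_outer_prod assms)

lemma cross_moment_add_right:
  assumes "finite_second_moment \<Omega> X" "finite_second_moment \<Omega> Y" "finite_second_moment \<Omega> Z"
  shows "cross_moment \<Omega> Z (\<lambda>s. X s + Y s) = cross_moment \<Omega> Z X + cross_moment \<Omega> Z Y"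
  by (simp add: cross_moment_def integrable_outer_prod assms
      bounded_bilinear.add_right[OF bounded_bilinear_outer_prod])

lemma cross_moment_diff_right:
  assumes "finite_second_moment \<Omega> X" "finite_second_moment \<Omega> Y" "finite_second_moment \<Omega> Z"
  shows "cross_moment \<Omega> Z (\<lambda>s. X s - Y s) = cross_moment \<Omega> Z X - cross_moment \<Omega> Z Y"
  by (simp add: cross_moment_def integrable_outer_prod assms
      bounded_bilinear.diff_right[OF bounded_bilinear_outer_prod])

lemma cross_moment_mult_left:
  assumes "finite_second_moment \<Omega> X" "finite_second_moment \<Omega> Y"
  shows "cross_moment \<Omega> (\<lambda>s. M *v X s) Y = M ** cross_moment \<Omega> X Y"
  using integral_bounded_linear[OF bounded_linear_matrix_mult_right integrable_outer_prod[OF assms]]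
  by (simp add: cross_moment_def outer_prod_mult_left)

lemma cross_moment_mult_right:
  assumes "finite_second_moment \<Omega> X" "finite_second_moment \<Omega> Y"
  shows "cross_moment \<Omega> X (\<lambda>s. M *v Y s) = cross_moment \<Omega> X Y ** transpose M"
  using cross_moment_mult_left[OF assms(2,1), of M] transpose_cross_moment[OF assms]
    transpose_cross_moment[OF finite_second_moment_mult[OF assms(2), of M] assms(1)]
  by (metis matrix_transpose_mul transpose_transpose)

lemma mse_eq_cross_moment: "mse \<Omega> X Y = cross_moment \<Omega> (\<lambda>s. X s - Y s) (\<lambda>s. X s - Y s)"
  by (simp add: mse_def cross_moment_def)

lemma mse_commute:
  fixes X Y :: "'s \<Rightarrow> real^'n"
  shows "mse \<Omega> X Y = mse \<Omega> Y X"
proof -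
  have "outer_prod (x - y) (x - y) = outer_prod (y - x) (y - x)" for x y :: "real^'n"
    by (simp add: outer_prod_def vec_eq_iff algebra_simps)
  then show ?thesis
    by (simp add: mse_def)
qed

lemma cross_cov_eq_cross_moment:
  assumes "integral\<^sup>L \<Omega> X = 0" "integral\<^sup>L \<Omega> Y = 0"
  shows "cross_cov \<Omega> X Y = cross_moment \<Omega> X Y"
  by (simp add: cross_cov_def cross_moment_def assms)

lemma (in prob_space) uncorrelated_centered:
  assumes X: "finite_second_moment M X" and Y: "finite_second_moment M Y"
    and mean: "integral\<^sup>L M X = 0" and unc: "uncorrelated M X Y"
  shows "cross_moment M X Y = 0"
proof -
  define c where "c = integral\<^sup>L M Y"
  have c: "finite_second_moment M (\<lambda>s. c)"
    by (simp add: finite_second_moment_def)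
  have "cross_moment M X (\<lambda>s. c) = outer_prod (integral\<^sup>L M X) c"
    unfolding cross_moment_def
    by (rule integral_bounded_linear[OF bounded_bilinear.bounded_linear_left
          [OF bounded_bilinear_outer_prod] finite_second_moment_integrable[OF X]])
  also have "\<dots> = 0"
    by (simp add: mean outer_prod_def vec_eq_iff)
  finally have "cross_moment M X (\<lambda>s. Y s - c) = cross_moment M X Y"
    using cross_moment_diff_right[OF Y c X] by simp
  with unc show ?thesis
    by (simp add: uncorrelated_def cross_cov_def cross_moment_def mean c_def)
qed

lemma (in prob_space) finite_second_moment_gaussian:
  fixes X :: "'a \<Rightarrow> real^'n"
  assumes "gaussian_vector M X"
  shows "finite_second_moment M X"
proof -
  have [measurable]: "X \<in> borel_measurable M"
    using assms by (simp add: gaussian_vector_def)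
  have "integrable M (\<lambda>s. (u \<bullet> X s)\<^sup>2)" for u
  proof -
    obtain \<mu> \<sigma> where \<mu>\<sigma>: "0 \<le> \<sigma>" "if \<sigma> = 0 then AE s in M. u \<bullet> X s = \<mu>
         else distributed M lborel (\<lambda>s. u \<bullet> X s) (\<lambda>t. ennreal (normal_density \<mu> \<sigma> t))"
      using assms by (metis gaussian_vector_def)
    show ?thesis
    proof (cases "\<sigma> = 0")
      case True
      then have "AE s in M. (u \<bullet> X s)\<^sup>2 = \<mu>\<^sup>2"
        using \<mu>\<sigma>(2) by auto
      then show ?thesis
        by (subst integrable_cong_AE[where g = "\<lambda>_. \<mu>\<^sup>2"]) auto
    next
      case False
      then have \<sigma>: "0 < \<sigma>"
        and D: "distributed M lborel (\<lambda>s. u \<bullet> X s) (\<lambda>t. ennreal (normal_density \<mu> \<sigma> t))"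
        using \<mu>\<sigma> by auto
      have "(\<lambda>t. normal_density \<mu> \<sigma> t * t\<^sup>2) =
          (\<lambda>t. normal_density \<mu> \<sigma> t * (t - \<mu>) ^ 2 + 2 * \<mu> * (normal_density \<mu> \<sigma> t * (t - \<mu>) ^ 1)
             + \<mu>\<^sup>2 * (normal_density \<mu> \<sigma> t * (t - \<mu>) ^ 0))"
        by (auto simp: power2_eq_square algebra_simps)
      then have "integrable lborel (\<lambda>t. normal_density \<mu> \<sigma> t * t\<^sup>2)"
        using integrable_normal_moment[OF \<sigma>, of \<mu> 2] integrable_normal_moment[OF \<sigma>, of \<mu> 1]
          integrable_normal_moment[OF \<sigma>, of \<mu> 0]
        by (simp only:) (intro Bochner_Integration.integrable_add integrable_mult_right)
      then show ?thesis
        using distributed_integrable[OF D, of "\<lambda>t. t\<^sup>2"] by simp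
    qed
  qed
  from this[of "axis i 1" for i] have "integrable M (\<lambda>s. \<Sum>i\<in>UNIV. (X s $ i)\<^sup>2)"
    by (intro Bochner_Integration.integrable_sum) (simp add: inner_axis' inner_axis)
  moreover have "(norm x)\<^sup>2 = (\<Sum>i\<in>UNIV. (x $ i)\<^sup>2)" for x :: "real^'n"
    by (simp add: norm_vec_def L2_set_def sum_nonneg)
  ultimately show ?thesis
    by (simp add: finite_second_moment_def)
qed

lemma white_gaussian_noiseD:
  assumes "prob_space \<Omega>" "white_gaussian_noise \<Omega> w Q"
  shows "finite_second_moment \<Omega> (w k)" "integral\<^sup>L \<Omega> (w k) = 0" "cross_moment \<Omega> (w k) (w k) = Q"
    "j \<noteq> k \<Longrightarrow> cross_moment \<Omega> (w j) (w k) = 0"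
proof -
  show "finite_second_moment \<Omega> (w k)" "integral\<^sup>L \<Omega> (w k) = 0"
    using assms(2) prob_space.finite_second_moment_gaussian[OF assms(1)]
    by (auto simp: white_gaussian_noise_def)
  have "cross_cov \<Omega> (w j) (w k) = cross_moment \<Omega> (w j) (w k)" for j
    using assms(2) by (intro cross_cov_eq_cross_moment) (auto simp: white_gaussian_noise_def)
  then show "cross_moment \<Omega> (w k) (w k) = Q" "j \<noteq> k \<Longrightarrow> cross_moment \<Omega> (w j) (w k) = 0"
    using assms(2) by (metis white_gaussian_noise_def uncorrelated_def)+
qed

subsection \<open>Error propagation\<close>

lemma psd_matrix_cross_moment:
  assumes "finite_second_moment \<Omega> X"
  shows "psd_matrix (cross_moment \<Omega> X X)"
proof -
  have "u \<bullet> (cross_moment \<Omega> X X *v u) = (\<integral>s. (u \<bullet> X s)\<^sup>2 \<partial>\<Omega>)" for u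
    using integral_bounded_linear[OF bounded_linear_quadratic_form integrable_outer_prod[OF assms assms]]
    by (simp add: cross_moment_def quadratic_form_outer_prod)
  then show ?thesis
    using transpose_cross_moment[OF assms assms] by (simp add: psd_matrix_def)
qed

lemma cross_moment_add_orthogonal:
  assumes X: "finite_second_moment \<Omega> X" and Y: "finite_second_moment \<Omega> Y"
    and XY: "cross_moment \<Omega> X Y = 0"
  shows "cross_moment \<Omega> (\<lambda>s. X s + Y s) (\<lambda>s. X s + Y s) = cross_moment \<Omega> X X + cross_moment \<Omega> Y Y"
proof -
  have "cross_moment \<Omega> Y X = 0"
    using transpose_cross_moment[OF X Y] XY by (simp add: transpose_def vec_eq_iff)
  then show ?thesis
    using XY by (simp add: cross_moment_add_left cross_moment_add_right finite_second_moment_add X Y)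
qed

lemma linear_error_uncorrelated_with_future_noise:
  assumes fsm: "finite_second_moment \<Omega> (e 0)" "\<And>j. finite_second_moment \<Omega> (w j)"
      "\<And>j. finite_second_moment \<Omega> (v j)"
    and step: "\<And>j s. s \<in> space \<Omega> \<Longrightarrow>
        e (Suc j) s = F j *v e j s + G j *v w j s + K j *v v (Suc j) s"
    and init: "\<And>j. cross_moment \<Omega> (w j) (e 0) = 0" "\<And>j. cross_moment \<Omega> (v j) (e 0) = 0"
    and white: "\<And>i j. i \<noteq> j \<Longrightarrow> cross_moment \<Omega> (w i) (w j) = 0"
      "\<And>i j. i \<noteq> j \<Longrightarrow> cross_moment \<Omega> (v i) (v j) = 0"
    and wv: "\<And>i j. cross_moment \<Omega> (w i) (v j) = 0"
  shows "finite_second_moment \<Omega> (e n) \<and> (\<forall>j\<ge>n. cross_moment \<Omega> (w j) (e n) = 0)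
    \<and> (\<forall>j>n. cross_moment \<Omega> (v j) (e n) = 0)"
proof (induction n)
  case 0
  then show ?case
    using fsm init by simp
next
  case (Suc n)
  have vw: "cross_moment \<Omega> (v i) (w j) = 0" for i j
    using transpose_cross_moment[OF fsm(2,3), of j i] wv by (simp add: transpose_def vec_eq_iff)
  note fsm_intros = finite_second_moment_add finite_second_moment_mult fsm Suc[THEN conjunct1]
  have "finite_second_moment \<Omega> (e (Suc n))"
    using finite_second_moment_cong[of \<Omega>, OF step[of _ n]] by (simp add: fsm_intros)
  moreover have expand: "cross_moment \<Omega> Z (e (Suc n)) =
      cross_moment \<Omega> Z (e n) ** transpose (F n) + cross_moment \<Omega> Z (w n) ** transpose (G n)
      + cross_moment \<Omega> Z (v (Suc n)) ** transpose (K n)"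
    if "finite_second_moment \<Omega> Z" for Z :: "_ \<Rightarrow> real^'z"
  proof -
    have "cross_moment \<Omega> Z (e (Suc n))
        = cross_moment \<Omega> Z (\<lambda>s. F n *v e n s + G n *v w n s + K n *v v (Suc n) s)"
      by (rule cross_moment_cong) (simp_all add: step)
    then show ?thesis
      by (simp add: cross_moment_add_right cross_moment_mult_right fsm_intros that)
  qed
  ultimately show ?case
    using Suc by (auto simp: expand fsm white wv vw)
qed

lemma posterior_covariance_psd:
  assumes "psd_matrix (P 0)" "psd_matrix Q" "pos_def_matrix R" "inj ((*v) (H ** B))"
    and Ppred: "\<And>j. Ppred (Suc j) = A ** P j ** transpose A + Q"
    and C: "\<And>j. C (Suc j) = H ** Ppred (Suc j) ** transpose H + R"
    and P_update: "\<And>j. P (Suc j) =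
        Ppred (Suc j)
        - Ppred (Suc j) ** transpose H ** matrix_inv (C (Suc j)) ** H ** Ppred (Suc j)
        + (B - Ppred (Suc j) ** transpose H ** matrix_inv (C (Suc j)) ** H ** B)
          ** matrix_inv (transpose B ** transpose H ** matrix_inv (C (Suc j)) ** H ** B)
          ** transpose (B - Ppred (Suc j) ** transpose H ** matrix_inv (C (Suc j)) ** H ** B)"
  shows "psd_matrix (P n)"
proof (induction n)
  case 0
  show ?case by fact
next
  case (Suc n)
  have pred: "psd_matrix (Ppred (Suc n))"
    unfolding Ppred by (intro psd_matrix_add psd_matrix_congruence Suc assms(2))
  then have "pos_def_matrix (C (Suc n))"
    unfolding C by (intro pos_def_matrix_add psd_matrix_congruence assms(3))
  then have S: "psd_matrix (matrix_inv (transpose B ** transpose H ** matrix_inv (C (Suc n)) ** H ** B))"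
    by (intro pos_def_imp_psd pos_def_matrix_inv innovation_weight_pos_def assms(4))
  show ?case
    unfolding P_update
    by (intro psd_matrix_add psd_matrix_congruence S)
       (unfold C, rule psd_matrix_kalman_correction[OF pred assms(3)])
qed

theorem theorem4:
  fixes \<Omega> :: "'s measure"
    and m \<omega>\<^sub>m \<Delta>t D\<^sub>0 R\<^sub>0 :: real
    and A Q :: "real^2^2" and B :: "real^1^2" and H :: "real^2^1" and R :: "real^1^1"
    and Bp :: "real^2^1"
    and x xhat w :: "nat \<Rightarrow> 's \<Rightarrow> real^2"
    and y v f fhat :: "nat \<Rightarrow> 's \<Rightarrow> real^1"
    and P Ppred :: "nat \<Rightarrow> real^2^2"
    and C M :: "nat \<Rightarrow> real^1^1"
    and L :: "nat \<Rightarrow> real^1^2"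
    and k :: nat
  assumes prob: "prob_space \<Omega>"
    and pos: "m > 0" "\<omega>\<^sub>m > 0" "\<Delta>t > 0" "D\<^sub>0 > 0" "R\<^sub>0 > 0"
    and A: "A = matrix_exp (\<Delta>t *\<^sub>R A0_mat m \<omega>\<^sub>m)"
    and B: "B = integral {0..\<Delta>t} (\<lambda>\<tau>. matrix_exp (\<tau> *\<^sub>R A0_mat m \<omega>\<^sub>m)) ** B0_mat"
    and H: "H = H0_mat"
    and Q: "Q = integral {0..\<Delta>t} (\<lambda>\<tau>. matrix_exp (\<tau> *\<^sub>R A0_mat m \<omega>\<^sub>m) ** Q0_mat D\<^sub>0
                  ** matrix_exp (\<tau> *\<^sub>R transpose (A0_mat m \<omega>\<^sub>m)))"
    and R: "R = mat (R\<^sub>0 / \<Delta>t)"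
    and full_column_rank: "rank B = CARD(1)"
    and Bp: "Bp = pinv_full_col B"
    and w_noise: "white_gaussian_noise \<Omega> w Q"
    and v_noise: "white_gaussian_noise \<Omega> v R"
    and wv_uncorrelated: "\<And>i j. uncorrelated \<Omega> (w i) (v j)"
    and w_init_uncorrelated: "\<And>j. uncorrelated \<Omega> (w j) (x 0)" "\<And>j. uncorrelated \<Omega> (w j) (xhat 0)"
    and v_init_uncorrelated: "\<And>j. uncorrelated \<Omega> (v j) (x 0)" "\<And>j. uncorrelated \<Omega> (v j) (xhat 0)"
    and init_moments: "finite_second_moment \<Omega> (x 0)" "finite_second_moment \<Omega> (xhat 0)"
    and input_moments: "\<And>j. finite_second_moment \<Omega> (f j)"
    and dynamics: "\<And>j s. s \<in> space \<Omega> \<Longrightarrow> x (Suc j) s = A *v x j s + B *v f j s + w j s"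
    and measurement: "\<And>j s. s \<in> space \<Omega> \<Longrightarrow> y j s = H *v x j s + v j s"
    \<comment> \<open>\<open>P j\<close> and \<open>Ppred (Suc j)\<close> are the covariances with index pairs j|j and j+1|j\<close>
    and unbiased_init: "integral\<^sup>L \<Omega> (xhat 0) = integral\<^sup>L \<Omega> (x 0)"
    and P_init: "P 0 = mse \<Omega> (x 0) (xhat 0)"
    and Ppred: "\<And>j. Ppred (Suc j) = A ** P j ** transpose A + Q"
    and C: "\<And>j. C (Suc j) = H ** Ppred (Suc j) ** transpose H + R"
    and L: "\<And>j. L (Suc j) =
        Ppred (Suc j) ** transpose H ** matrix_inv (C (Suc j))
        + (B - Ppred (Suc j) ** transpose H ** matrix_inv (C (Suc j)) ** H ** B)
          ** matrix_inv (transpose B ** transpose H ** matrix_inv (C (Suc j)) ** H ** B)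
          ** transpose B ** transpose H ** matrix_inv (C (Suc j))"
    and P_update: "\<And>j. P (Suc j) =
        Ppred (Suc j)
        - Ppred (Suc j) ** transpose H ** matrix_inv (C (Suc j)) ** H ** Ppred (Suc j)
        + (B - Ppred (Suc j) ** transpose H ** matrix_inv (C (Suc j)) ** H ** B)
          ** matrix_inv (transpose B ** transpose H ** matrix_inv (C (Suc j)) ** H ** B)
          ** transpose (B - Ppred (Suc j) ** transpose H ** matrix_inv (C (Suc j)) ** H ** B)"
    and xhat_update: "\<And>j s. s \<in> space \<Omega> \<Longrightarrow>
        xhat (Suc j) s = A *v xhat j s + L (Suc j) *v (y (Suc j) s - H *v (A *v xhat j s))"
    and fhat: "\<And>j s. s \<in> space \<Omega> \<Longrightarrow> fhat j s = Bp *v (xhat (Suc j) s - A *v xhat j s)"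
    and M: "\<And>j. M (Suc j) = Bp ** L (Suc j)"
  shows "mse \<Omega> (fhat k) (f k) =
      M (Suc k) ** H ** A ** mse \<Omega> (xhat k) (x k) ** transpose A ** transpose H
        ** transpose (M (Suc k))
      + M (Suc k) ** H ** Q ** transpose H ** transpose (M (Suc k))
      + M (Suc k) ** R ** transpose (M (Suc k))"
proof -
  interpret prob_space \<Omega> by (rule prob)
  have HB: "inj ((*v) (H ** B))"
    unfolding H by (rule input_observable[OF pos(1,2,3) B full_column_rank])
  note w = white_gaussian_noiseD[OF prob w_noise] and v = white_gaussian_noiseD[OF prob v_noise]
  have R_pos: "pos_def_matrix R"
    unfolding R using pos by (intro pos_def_matrix_mat) simp
  have Q_psd: "psd_matrix Q"
    using psd_matrix_cross_moment[OF w(1)] w(3) by metis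
  have "psd_matrix (P 0)"
    unfolding P_init mse_eq_cross_moment
    by (intro psd_matrix_cross_moment finite_second_moment_diff init_moments)
  note P_psd = posterior_covariance_psd[OF this Q_psd R_pos HB Ppred C P_update]
  have LHB: "L (Suc j) ** H ** B = B" for j
  proof -
    have "pos_def_matrix (C (Suc j))"
      unfolding C Ppred by (intro pos_def_matrix_add psd_matrix_add psd_matrix_congruence P_psd Q_psd R_pos)
    from kalman_gain_decouples_input[OF this HB, of "Ppred (Suc j)"] show ?thesis
      by (simp add: L kalman_gain_def)
  qed

  define e where "e = (\<lambda>j s. x j s - xhat j s)"
  have innovation: "y (Suc j) s - H *v (A *v xhat j s)
      = (H ** A) *v e j s + (H ** B) *v f j s + H *v w j s + v (Suc j) s" if "s \<in> space \<Omega>" for j s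
    by (simp add: measurement dynamics that e_def matrix_vector_right_distrib
        matrix_vector_mult_diff_distrib flip: matrix_vector_mul_assoc)
  have correction: "L (Suc j) *v (y (Suc j) s - H *v (A *v xhat j s))
      = (L (Suc j) ** H ** A) *v e j s + B *v f j s + (L (Suc j) ** H) *v w j s + L (Suc j) *v v (Suc j) s"
    if "s \<in> space \<Omega>" for j s
    unfolding innovation[OF that]
    by (simp add: matrix_vector_right_distrib matrix_vector_mul_assoc matrix_mul_assoc LHB)
  have e_step: "e (Suc j) s = (A - L (Suc j) ** H ** A) *v e j s
      + (mat 1 - L (Suc j) ** H) *v w j s + (- L (Suc j)) *v v (Suc j) s" if "s \<in> space \<Omega>" for j s
  proof -
    have "e (Suc j) s = A *v e j s + B *v f j s + w j s - L (Suc j) *v (y (Suc j) s - H *v (A *v xhat j s))"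
      using that by (simp add: e_def dynamics xhat_update matrix_vector_mult_diff_distrib)
    then show ?thesis
      unfolding correction[OF that]
      by (simp add: matrix_vector_mult_diff_rdistrib matrix_vector_mult_minus)
  qed

  have e0: "cross_moment \<Omega> Z (e 0) = 0"
    if "finite_second_moment \<Omega> Z" "integral\<^sup>L \<Omega> Z = 0" "uncorrelated \<Omega> Z (x 0)" "uncorrelated \<Omega> Z (xhat 0)"
    for Z :: "'s \<Rightarrow> real^'z"
    using that by (simp add: e_def cross_moment_diff_right uncorrelated_centered init_moments)
  have wv: "cross_moment \<Omega> (w i) (v j) = 0" for i j
    by (intro uncorrelated_centered w v wv_uncorrelated)
  have e_fsm: "finite_second_moment \<Omega> (e k)"
    and we: "cross_moment \<Omega> (w k) (e k) = 0" and ve: "cross_moment \<Omega> (v (Suc k)) (e k) = 0"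
    using linear_error_uncorrelated_with_future_noise[where e = e and w = w and v = v and n = k, OF _ w(1) v(1) e_step]
    by (simp_all add: e0 w v wv w_init_uncorrelated v_init_uncorrelated)
      (simp_all add: e_def finite_second_moment_diff init_moments)
  have ew: "cross_moment \<Omega> (e k) (w k) = 0" and ev: "cross_moment \<Omega> (e k) (v (Suc k)) = 0"
    using transpose_cross_moment[OF w(1) e_fsm, of k] transpose_cross_moment[OF v(1) e_fsm, of "Suc k"] we ve
    by (simp_all add: transpose_def vec_eq_iff)

  define N where "N = M (Suc k)"
  have force_error: "fhat k s - f k s = (N ** H ** A) *v e k s + (N ** H) *v w k s + N *v v (Suc k) s"
    if "s \<in> space \<Omega>" for s
    using that correction[OF that, of k] pinv_full_col_left_inverse[OF full_column_rank]
    by (simp add: fhat xhat_update N_def M Bp matrix_vector_right_distrib matrix_vector_mul_assoc matrix_mul_assoc)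
  note fsm_intros = finite_second_moment_add finite_second_moment_mult e_fsm w(1) v(1)
  have "mse \<Omega> (fhat k) (f k) = cross_moment \<Omega>
      (\<lambda>s. (N ** H ** A) *v e k s + (N ** H) *v w k s + N *v v (Suc k) s)
      (\<lambda>s. (N ** H ** A) *v e k s + (N ** H) *v w k s + N *v v (Suc k) s)"
    unfolding mse_eq_cross_moment by (intro cross_moment_cong force_error)
  also have "\<dots> = cross_moment \<Omega> (\<lambda>s. (N ** H ** A) *v e k s) (\<lambda>s. (N ** H ** A) *v e k s)
      + cross_moment \<Omega> (\<lambda>s. (N ** H) *v w k s) (\<lambda>s. (N ** H) *v w k s)
      + cross_moment \<Omega> (\<lambda>s. N *v v (Suc k) s) (\<lambda>s. N *v v (Suc k) s)"
    by (simp add: cross_moment_add_orthogonal cross_moment_add_left cross_moment_mult_left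
        cross_moment_mult_right fsm_intros ew ev wv)
  also have "\<dots> = N ** H ** A ** cross_moment \<Omega> (e k) (e k) ** transpose (N ** H ** A)
      + N ** H ** Q ** transpose (N ** H) + N ** R ** transpose N"
    by (simp add: cross_moment_mult_left cross_moment_mult_right fsm_intros w v matrix_mul_assoc)
  also have "cross_moment \<Omega> (e k) (e k) = mse \<Omega> (xhat k) (x k)"
    by (subst mse_commute) (simp add: mse_eq_cross_moment e_def)
  finally show ?thesis
    by (simp add: N_def matrix_transpose_mul matrix_mul_assoc)
qed

end
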